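(* Let $\mathscr{H}$ be a complex Hilbert space and let $T\in \mathbb{B}(\mathscr{H})$. Then $$w(T)=\sqrt{\frac{1}{4}\|T^*T+TT^*\|+\frac{1}{4}\left| \|Re(T)+Im(T)\|^2-\|Re(T)-Im(T)\|^2\right|}$$ if and only if both $\|T^*T+TT^*\|=\|Re(T)+Im(T)\|^2+ \|Re(T)-Im(T)\|^2$ and $$w(T)=\max \left\{ \frac{\|Re(T)+Im(T)\|}{\sqrt{2}}, \frac{ \|Re(T)-Im(T)\|} {\sqrt{2}} \right\}.$$
   Context: $\mathbb{B}(\mathscr{H})$ denotes the bounded linear operators on $\mathscr{H}$, $\|\cdot\|$ the operator norm. $Re(T)=\frac12(T+T^* )$ and $Im(T)=\frac1{2i}(T-T^* )$. The numerical radius is $w(T)=\sup\{|\langle Tx,x\rangle| : x\in\mathscr{H},\ \|x\|=1\}$. *)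

theory Defs
  imports "HOL-Analysis.Analysis"
begin

class complex_vector = real_vector +
  fixes scaleC :: "complex \<Rightarrow> 'a \<Rightarrow> 'a" (infixr \<open>*\<^sub>C\<close> 75)
  assumes scaleC_add_right: "c *\<^sub>C (x + y) = c *\<^sub>C x + c *\<^sub>C y"
    and scaleC_add_left: "(c + d) *\<^sub>C x = c *\<^sub>C x + d *\<^sub>C x"
    and scaleC_scaleC: "c *\<^sub>C d *\<^sub>C x = (c * d) *\<^sub>C x"
    and scaleC_one: "1 *\<^sub>C x = x"
    and scaleR_scaleC: "r *\<^sub>R x = complex_of_real r *\<^sub>C x"

text \<open>The inner product is linear in its first argument.\<close>

class complex_inner = complex_vector + real_normed_vector +
  fixes cinner :: "'a \<Rightarrow> 'a \<Rightarrow> complex"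
  assumes cinner_commute: "cinner x y = cnj (cinner y x)"
    and cinner_add_left: "cinner (x + y) z = cinner x z + cinner y z"
    and cinner_scaleC_left: "cinner (c *\<^sub>C x) y = c * cinner x y"
    and cinner_ge_zero: "0 \<le> Re (cinner x x)"
    and cinner_eq_zero_iff: "cinner x x = 0 \<longleftrightarrow> x = 0"
    and norm_eq_sqrt_cinner: "norm x = sqrt (Re (cinner x x))"

class chilbert_space = complex_inner + complete_space

definition bounded_clinear :: "('a::complex_inner \<Rightarrow> 'b::complex_inner) \<Rightarrow> bool" where
  "bounded_clinear T \<longleftrightarrow> bounded_linear T \<and> (\<forall>c x. T (c *\<^sub>C x) = c *\<^sub>C T x)"

text \<open>For a bounded complex-linear operator on a Hilbert space the adjoint exists by the Riesz
  representation theorem; it is unique because the inner product is nondegenerate.\<close>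

definition hadjoint :: "('a::chilbert_space \<Rightarrow> 'a) \<Rightarrow> 'a \<Rightarrow> 'a" where
  "hadjoint T = (THE S. \<forall>x y. cinner (T x) y = cinner x (S y))"

definition op_Re :: "('a::chilbert_space \<Rightarrow> 'a) \<Rightarrow> 'a \<Rightarrow> 'a" where
  "op_Re T = (\<lambda>x. (1 / 2) *\<^sub>C (T x + hadjoint T x))"

definition op_Im :: "('a::chilbert_space \<Rightarrow> 'a) \<Rightarrow> 'a \<Rightarrow> 'a" where
  "op_Im T = (\<lambda>x. (1 / (2 * \<i>)) *\<^sub>C (T x - hadjoint T x))"

text \<open>On the zero space there are no unit vectors, and the supremum of the empty set of reals is
  then an unspecified number; all operator norms vanish there, so the equivalence stated for the
  numerical radius holds whatever that number is.\<close>

definition numerical_radius :: "('a::chilbert_space \<Rightarrow> 'a) \<Rightarrow> real" where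
  "numerical_radius T = (SUP x\<in>{x. norm x = 1}. cmod (cinner (T x) x))"

end

theory Submission
  imports Defs
begin

text \<open>Put \<open>P = Re T + Im T\<close> and \<open>M = Re T - Im T\<close>. Since \<open>P\<^sup>2 + M\<^sup>2 = T\<^sup>*T + TT\<^sup>*\<close>, the norm of
  \<open>T\<^sup>*T + TT\<^sup>*\<close> is at most \<open>\<parallel>P\<parallel>\<^sup>2 + \<parallel>M\<parallel>\<^sup>2\<close>. Both \<open>P\<close> and \<open>M\<close> are of the form \<open>\<alpha>T + (\<alpha>T)\<^sup>*\<close> with
  \<open>\<bar>\<alpha>\<bar> = 1 / \<surd>2\<close>; the norm of a self-adjoint operator being its numerical radius, \<open>w(T)\<close> is at
  least \<open>max \<parallel>P\<parallel> \<parallel>M\<parallel> / \<surd>2\<close>. The right-hand side of the first equation is therefore at most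
  \<open>max \<parallel>P\<parallel> \<parallel>M\<parallel> / \<surd>2 \<le> w(T)\<close>, and equality holds iff both estimates are sharp.\<close>

section \<open>Inner product identities and the Cauchy-Schwarz inequality\<close>

lemma cinner_add_right: "cinner x (y + z) = cinner x y + cinner x z"
  for x y z :: "'a::complex_inner"
  by (metis cinner_add_left cinner_commute complex_cnj_add)

lemma cinner_scaleC_right: "cinner x (c *\<^sub>C y) = cnj c * cinner x y"
  for x y :: "'a::complex_inner"
  by (metis cinner_commute cinner_scaleC_left complex_cnj_mult)

lemma cinner_scaleR_left: "cinner (r *\<^sub>R x) y = of_real r * cinner x y"
  for x y :: "'a::complex_inner"
  by (simp add: scaleR_scaleC cinner_scaleC_left)

lemma cinner_scaleR_right: "cinner x (r *\<^sub>R y) = of_real r * cinner x y"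
  for x y :: "'a::complex_inner"
  by (simp add: scaleR_scaleC cinner_scaleC_right)

lemma cinner_minus_left: "cinner (- x) y = - cinner x y"
  for x y :: "'a::complex_inner"
  using cinner_scaleR_left[of "-1" x y] by simp

lemma cinner_minus_right: "cinner x (- y) = - cinner x y"
  for x y :: "'a::complex_inner"
  using cinner_scaleR_right[of x "-1" y] by simp

lemma cinner_diff_left: "cinner (x - y) z = cinner x z - cinner y z"
  for x y z :: "'a::complex_inner"
  using cinner_add_left[of x "- y" z] by (simp add: cinner_minus_left)

lemma cinner_diff_right: "cinner x (y - z) = cinner x y - cinner x z"
  for x y z :: "'a::complex_inner"
  using cinner_add_right[of x y "- z"] by (simp add: cinner_minus_right)

lemma Re_cinner_commute: "Re (cinner x y) = Re (cinner y x)"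
  for x y :: "'a::complex_inner"
  by (metis cinner_commute complex_cnj(1) complex.sel(1) cnj.sel(1))

lemma power2_norm_eq_cinner: "(norm x)\<^sup>2 = Re (cinner x x)"
  for x :: "'a::complex_inner"
  by (simp add: norm_eq_sqrt_cinner cinner_ge_zero)

lemma power2_norm_add: "(norm (x + y))\<^sup>2 = (norm x)\<^sup>2 + 2 * Re (cinner x y) + (norm y)\<^sup>2"
  for x y :: "'a::complex_inner"
  using Re_cinner_commute[of x y]
  by (simp add: power2_norm_eq_cinner cinner_add_left cinner_add_right)

lemma power2_norm_diff: "(norm (x - y))\<^sup>2 = (norm x)\<^sup>2 - 2 * Re (cinner x y) + (norm y)\<^sup>2"
  for x y :: "'a::complex_inner"
  using power2_norm_add[of x "- y"] by (simp add: cinner_minus_right)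

text \<open>The triangle inequality is part of the class, so comparing the expansions of both
  squared sides leaves exactly this bound.\<close>

lemma Re_cinner_le_norm: "Re (cinner x y) \<le> norm x * norm y"
  for x y :: "'a::complex_inner"
proof -
  have "(norm (x + y))\<^sup>2 \<le> (norm x + norm y)\<^sup>2"
    by (simp add: norm_triangle_ineq power_mono)
  then show ?thesis
    by (simp add: power2_norm_add power2_sum)
qed

lemma abs_Re_cinner_le_norm: "\<bar>Re (cinner x y)\<bar> \<le> norm x * norm y"
  for x y :: "'a::complex_inner"
  using Re_cinner_le_norm[of x y] Re_cinner_le_norm[of "- x" y]
  by (simp add: cinner_minus_left)

lemma scaleC_diff_right: "c *\<^sub>C (x - y) = c *\<^sub>C x - c *\<^sub>C y"
  for x y :: "'a::complex_vector"
  by (metis add_diff_cancel diff_add_cancel scaleC_add_right)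

lemma norm_scaleC: "norm (c *\<^sub>C x) = cmod c * norm x"
  for x :: "'a::complex_inner"
proof -
  have "cinner (c *\<^sub>C x) (c *\<^sub>C x) = of_real ((cmod c)\<^sup>2) * cinner x x"
    by (simp add: cinner_scaleC_left cinner_scaleC_right complex_norm_square mult.assoc
        del: of_real_power)
  then have "(norm (c *\<^sub>C x))\<^sup>2 = (cmod c * norm x)\<^sup>2"
    by (simp add: power2_norm_eq_cinner power_mult_distrib)
  then show ?thesis
    by (simp add: power2_eq_iff_nonneg)
qed

lemma cmod_cinner_le_norm: "cmod (cinner x y) \<le> norm x * norm y"
  for x y :: "'a::complex_inner"
proof (cases "cinner x y = 0")
  case False
  \<comment> \<open>Rotating \<open>x\<close> by the conjugate phase of \<open>cinner x y\<close>
    makes the pairing real and nonnegative, so the bound for real parts applies.\<close>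
  define c where "c = cnj (cinner x y) / cmod (cinner x y)"
  have "cmod c = 1"
    using False by (simp add: c_def norm_divide)
  have "c * cinner x y = cmod (cinner x y)"
    using False complex_norm_square[of "cinner x y"]
    by (simp add: c_def power2_eq_square field_simps)
  then have "cmod (cinner x y) = Re (cinner (c *\<^sub>C x) y)"
    by (simp add: cinner_scaleC_left)
  also have "\<dots> \<le> norm (c *\<^sub>C x) * norm y"
    by (rule Re_cinner_le_norm)
  finally show ?thesis
    by (simp add: norm_scaleC \<open>cmod c = 1\<close>)
qed simp

lemma bounded_linear_scaleC: "bounded_linear (\<lambda>x::'a::complex_inner. c *\<^sub>C x)"
  by (rule bounded_linear_intro[of _ "cmod c"])
    (simp_all add: scaleC_add_right scaleR_scaleC scaleC_scaleC norm_scaleC mult.commute)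

section \<open>Riesz representation in real form\<close>

text \<open>The representing vector is the minimiser of \<open>\<parallel>x\<parallel>\<^sup>2 / 2 - f x\<close>; by the parallelogram law,
  minimising sequences are Cauchy.\<close>

lemma riesz_representation_real:
  fixes f :: "'a::chilbert_space \<Rightarrow> real"
  assumes "bounded_linear f"
  shows "\<exists>u. \<forall>x. f x = Re (cinner x u)"
proof -
  interpret f: bounded_linear f by fact
  define J where "J x = (norm x)\<^sup>2 / 2 - f x" for x
  obtain K where K: "\<And>x. norm (f x) \<le> norm x * K"
    using f.bounded by blast
  \<comment> \<open>Completing the square in \<open>norm x\<close> after
    \<open>f x \<le> norm x * K\<close>.\<close>
  have "J x \<ge> - K\<^sup>2 / 2" for x
  proof -
    have "0 \<le> (norm x - K)\<^sup>2" by simp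
    then show ?thesis
      using K[of x] by (simp add: J_def power2_diff algebra_simps)
  qed
  then have bdd: "bdd_below (range J)"
    by (auto simp: bdd_below_def)
  define d where "d = Inf (range J)"
  have d_le: "d \<le> J x" for x
    unfolding d_def by (rule cInf_lower) (use bdd in auto)
  have "\<exists>x. J x < d + 1 / Suc n" for n :: nat
    using cInf_lessD[of "range J" "d + 1 / Suc n"] by (auto simp: d_def)
  then obtain X where X: "\<And>n. J (X n) < d + 1 / Suc n"
    by metis
  have parallelogram: "(norm (x - y))\<^sup>2 / 4 \<le> J x + J y - 2 * d" for x y
  proof -
    \<comment> \<open>At the midpoint the values of \<open>f\<close> cancel by linearity, and only
      the quadratic parts remain.\<close>
    have "(norm (x - y))\<^sup>2 / 4 = J x + J y - 2 * J ((1/2) *\<^sub>R (x + y))"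
      by (simp add: J_def power2_norm_diff power2_norm_add f.scaleR f.add power_mult_distrib
          power_divide cinner_scaleR_left cinner_scaleR_right field_simps)
    then show ?thesis
      using d_le[of "(1/2) *\<^sub>R (x + y)"] by simp
  qed
  have "Cauchy X"
  proof (rule metric_CauchyI)
    fix e :: real
    assume "0 < e"
    then obtain N :: nat where N: "inverse (Suc N) < e\<^sup>2 / 8"
      using reals_Archimedean[of "e\<^sup>2 / 8"] by auto
    \<comment> \<open>Two errors of \<open>e\<^sup>2 / 8\<close> add up to
      \<open>e\<^sup>2 / 4\<close>, which matches the factor 1/4 in
      \<open>parallelogram\<close>.\<close>
    have small: "J (X n) < d + e\<^sup>2 / 8" if "n \<ge> N" for n
    proof -
      have "1 / real (Suc n) \<le> inverse (Suc N)"
        using that by (simp add: field_simps)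
      then show ?thesis using X[of n] N by linarith
    qed
    have "dist (X m) (X n) < e" if "m \<ge> N" "n \<ge> N" for m n
    proof -
      have "(norm (X m - X n))\<^sup>2 < e\<^sup>2"
        using parallelogram[of "X m" "X n"] small[OF that(1)] small[OF that(2)] by linarith
      then show ?thesis
        using \<open>0 < e\<close> by (simp add: dist_norm power2_less_imp_less)
    qed
    then show "\<exists>N. \<forall>m\<ge>N. \<forall>n\<ge>N. dist (X m) (X n) < e" by blast
  qed
  then obtain u where u: "X \<longlonglongrightarrow> u"
    using Cauchy_convergent convergent_def by blast
  have "(\<lambda>n. J (X n)) \<longlonglongrightarrow> J u"
    unfolding J_def by (intro tendsto_intros u f.tendsto) simp
  moreover have "(\<lambda>n. d + 1 / Suc n) \<longlonglongrightarrow> d + 0"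
    by (intro tendsto_intros LIMSEQ_Suc[OF lim_1_over_n])
  ultimately have "J u \<le> d + 0"
    by (rule LIMSEQ_le) (use X less_imp_le in blast)
  then have min: "J u \<le> J x" for x
    using d_le[of x] by simp
  have "f x = Re (cinner x u)" for x
  proof -
    \<comment> \<open>\<open>a\<close> is the derivative of \<open>J\<close> at \<open>u\<close> in
      direction \<open>x\<close>; it has to vanish because \<open>u\<close> is a minimiser.\<close>
    define a where "a = Re (cinner x u) - f x"
    have quad: "0 \<le> t * a + t\<^sup>2 * (norm x)\<^sup>2 / 2" for t
      using min[of "u + t *\<^sub>R x"] Re_cinner_commute[of u x]
      by (simp add: J_def a_def power2_norm_add f.add f.scaleR cinner_scaleR_right
          power_mult_distrib algebra_simps)
    \<comment> \<open>At \<open>t = - a / s\<close> the linear term outweighs the quadratic one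
      unless \<open>a = 0\<close>. The summand 1 keeps \<open>s\<close> positive when
      \<open>x = 0\<close>.\<close>
    define s where "s = (norm x)\<^sup>2 + 1"
    have "s > 0" by (simp add: s_def add_nonneg_pos)
    have "0 \<le> (- (a / s)) * a + (- (a / s))\<^sup>2 * (norm x)\<^sup>2 / 2"
      by (rule quad)
    also have "\<dots> = - (a\<^sup>2 / s\<^sup>2) * (s - (norm x)\<^sup>2 / 2)"
      using \<open>s > 0\<close> by (simp add: power2_eq_square field_simps)
    finally have "(a\<^sup>2 / s\<^sup>2) * (s - (norm x)\<^sup>2 / 2) \<le> 0" by simp
    moreover have "s - (norm x)\<^sup>2 / 2 > 0"
      using zero_le_power2[of "norm x"] unfolding s_def by linarith
    ultimately have "a\<^sup>2 / s\<^sup>2 \<le> 0"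
      by (metis mult_pos_pos not_less)
    then have "a = 0"
      using \<open>s > 0\<close> by (simp add: divide_le_0_iff)
    then show ?thesis by (simp add: a_def)
  qed
  then show ?thesis by blast
qed

section \<open>The adjoint operator\<close>

lemma cinner_eqI:
  fixes u v :: "'a::complex_inner"
  assumes "\<And>x. cinner x u = cinner x v"
  shows "u = v"
  using assms[of "u - v"] cinner_eq_zero_iff[of "u - v"] by (simp add: cinner_diff_right)

text \<open>For each fixed \<open>y\<close>, the real functional \<open>Re (cinner (T x) y)\<close>
  of \<open>x\<close> is bounded, and its Riesz vector serves as the value of the adjoint at
  \<open>y\<close>.\<close>

lemma hadjoint_exists:
  fixes T :: "'a::chilbert_space \<Rightarrow> 'a"
  assumes "bounded_clinear T"
  shows "\<exists>S. \<forall>x y. cinner (T x) y = cinner x (S y)"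
proof -
  interpret T: bounded_linear T
    using assms by (simp add: bounded_clinear_def)
  have T_scaleC: "T (c *\<^sub>C x) = c *\<^sub>C T x" for c x
    using assms by (simp add: bounded_clinear_def)
  have "\<exists>u. \<forall>x. cinner (T x) y = cinner x u" for y
  proof -
    obtain K where K: "\<And>x. norm (T x) \<le> norm x * K"
      using T.bounded by blast
    have "bounded_linear (\<lambda>x. Re (cinner (T x) y))"
    proof (rule bounded_linear_intro[of _ "K * norm y"])
      show "norm (Re (cinner (T x) y)) \<le> norm x * (K * norm y)" for x
        using order_trans[OF abs_Re_cinner_le_norm[of "T x" y] mult_right_mono[OF K[of x] norm_ge_zero]]
        by (simp add: mult.assoc)
    qed (simp_all add: T.add T.scaleR cinner_add_left cinner_scaleR_left)
    then obtain u where u: "\<And>x. Re (cinner (T x) y) = Re (cinner x u)"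
      using riesz_representation_real by fast
    \<comment> \<open>Since \<open>Re (\<i> * z) = - Im z\<close>, complex linearity recovers the
      imaginary parts from the real parts at \<open>\<i> *\<^sub>C x\<close>.\<close>
    have "Im (cinner (T x) y) = Im (cinner x u)" for x
      using u[of "\<i> *\<^sub>C x"] by (simp add: T_scaleC cinner_scaleC_left)
    then show ?thesis
      using u complex_eqI by blast
  qed
  then show ?thesis by metis
qed

text \<open>This discharges the definite description; every later fact about \<open>hadjoint\<close>
  rests on this identity.\<close>

lemma cinner_hadjoint_right:
  fixes T :: "'a::chilbert_space \<Rightarrow> 'a"
  assumes "bounded_clinear T"
  shows "cinner x (hadjoint T y) = cinner (T x) y"
proof -
  have "\<exists>!S. \<forall>x y. cinner (T x) y = cinner x (S y)"
  proof (rule ex_ex1I)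
    show "\<exists>S. \<forall>x y. cinner (T x) y = cinner x (S y)"
      by (rule hadjoint_exists) fact
    fix S S' :: "'a \<Rightarrow> 'a"
    assume "\<forall>x y. cinner (T x) y = cinner x (S y)" "\<forall>x y. cinner (T x) y = cinner x (S' y)"
    then show "S = S'"
      by (intro ext cinner_eqI) simp
  qed
  from theI'[OF this] have "\<forall>x y. cinner (T x) y = cinner x (hadjoint T y)"
    by (fold hadjoint_def)
  then show ?thesis by (simp only:)
qed

lemma cinner_hadjoint_left:
  fixes T :: "'a::chilbert_space \<Rightarrow> 'a"
  assumes "bounded_clinear T"
  shows "cinner (hadjoint T x) y = cinner x (T y)"
proof -
  have "cinner (hadjoint T x) y = cnj (cinner (T y) x)"
    by (subst cinner_commute) (simp only: cinner_hadjoint_right[OF assms])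
  also have "\<dots> = cinner x (T y)"
    by (rule cinner_commute[symmetric])
  finally show ?thesis .
qed

text \<open>Linearity follows by pairing with arbitrary vectors, and any bound \<open>K\<close> for
  \<open>T\<close> is inherited: the squared norm of \<open>hadjoint T x\<close> is a pairing of
  \<open>T (hadjoint T x)\<close> with \<open>x\<close>, and one factor cancels.\<close>

lemma bounded_clinear_hadjoint:
  fixes T :: "'a::chilbert_space \<Rightarrow> 'a"
  assumes "bounded_clinear T"
  shows "bounded_clinear (hadjoint T)"
proof -
  interpret T: bounded_linear T
    using assms by (simp add: bounded_clinear_def)
  note adj = cinner_hadjoint_right[OF assms]
  obtain K where K: "\<And>x. norm (T x) \<le> norm x * K" and "K \<ge> 0"
    using T.nonneg_bounded by blast
  have add: "hadjoint T (x + y) = hadjoint T x + hadjoint T y" for x y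
    by (rule cinner_eqI) (simp add: adj cinner_add_right)
  have scaleC: "hadjoint T (c *\<^sub>C x) = c *\<^sub>C hadjoint T x" for c x
    by (rule cinner_eqI) (simp add: adj cinner_scaleC_right)
  have "norm (hadjoint T x) \<le> norm x * K" for x
  proof (cases "hadjoint T x = 0")
    case False
    have "(norm (hadjoint T x))\<^sup>2 = Re (cinner (T (hadjoint T x)) x)"
      by (simp add: power2_norm_eq_cinner adj)
    also have "\<dots> \<le> norm (T (hadjoint T x)) * norm x"
      by (rule Re_cinner_le_norm)
    also have "\<dots> \<le> norm (hadjoint T x) * K * norm x"
      by (intro mult_right_mono K) simp
    finally have "norm (hadjoint T x) * norm (hadjoint T x) \<le> norm (hadjoint T x) * (norm x * K)"
      by (simp only: power2_eq_square mult_ac)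
    then show ?thesis
      using False by (simp only: mult_le_cancel_left_pos zero_less_norm_iff not_False_eq_True)
  qed (simp add: \<open>K \<ge> 0\<close>)
  then have "bounded_linear (hadjoint T)"
    by (intro bounded_linear_intro[of _ K]) (simp_all add: add scaleR_scaleC scaleC)
  then show ?thesis
    by (simp add: bounded_clinear_def scaleC)
qed

section \<open>Self-adjoint operators and the numerical radius\<close>

text \<open>Polarisation writes \<open>4 * Re (cinner (S x) y)\<close> as a difference of two values
  of the quadratic form; the parallelogram law then sums their bounds.\<close>

lemma onorm_selfadjoint_le:
  fixes S :: "'a::complex_inner \<Rightarrow> 'a"
  assumes "bounded_linear S"
    and selfadjoint: "\<And>x y. cinner (S x) y = cinner x (S y)"
    and bound: "\<And>x. cmod (cinner (S x) x) \<le> c * (norm x)\<^sup>2"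
    and "c \<ge> 0"
  shows "onorm S \<le> c"
proof (rule onorm_bound)
  interpret S: bounded_linear S by fact
  fix x
  show "norm (S x) \<le> c * norm x"
  proof (cases "x = 0 \<or> S x = 0")
    case True
    then show ?thesis using \<open>c \<ge> 0\<close> by (auto simp: S.zero)
  next
    case False
    \<comment> \<open>\<open>S x\<close> rescaled to the length of \<open>x\<close>: the pairing
      with \<open>S x\<close> becomes \<open>norm x * norm (S x)\<close>, and the parallelogram law
      yields \<open>4 * (norm x)\<^sup>2\<close>.\<close>
    define y where "y = (norm x / norm (S x)) *\<^sub>R S x"
    have norm_y: "norm y = norm x"
      using False by (simp add: y_def)
    have "Re (cinner (S x) y) = norm x / norm (S x) * (norm (S x))\<^sup>2"
      by (simp add: y_def cinner_scaleR_right power2_norm_eq_cinner)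
    also have "\<dots> = norm x * norm (S x)"
      using False by (simp add: power2_eq_square)
    finally have Sxy: "Re (cinner (S x) y) = norm x * norm (S x)" .
    have "Re (cinner (S y) x) = Re (cinner (S x) y)"
      using Re_cinner_commute selfadjoint by metis
    then have "4 * Re (cinner (S x) y)
        = Re (cinner (S (x + y)) (x + y)) - Re (cinner (S (x - y)) (x - y))"
      by (simp add: S.add S.diff cinner_add_left cinner_add_right cinner_diff_left cinner_diff_right)
    also have "\<dots> \<le> cmod (cinner (S (x + y)) (x + y)) + cmod (cinner (S (x - y)) (x - y))"
      using abs_Re_le_cmod[of "cinner (S (x + y)) (x + y)"]
        abs_Re_le_cmod[of "cinner (S (x - y)) (x - y)"] by linarith
    also have "\<dots> \<le> c * (norm (x + y))\<^sup>2 + c * (norm (x - y))\<^sup>2"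
      by (intro add_mono bound)
    also have "\<dots> = 4 * (c * (norm x)\<^sup>2)"
      by (simp add: power2_norm_add power2_norm_diff norm_y algebra_simps)
    finally have "norm x * norm (S x) \<le> norm x * (c * norm x)"
      by (simp add: Sxy power2_eq_square algebra_simps)
    then show ?thesis
      using False by simp
  qed
qed fact

lemma cmod_cinner_le_numerical_radius:
  fixes T :: "'a::chilbert_space \<Rightarrow> 'a"
  assumes "bounded_clinear T"
  shows "cmod (cinner (T x) x) \<le> numerical_radius T * (norm x)\<^sup>2"
proof (cases "x = 0")
  \<comment> \<open>Both sides vanish at 0, so the unspecified value of the numerical radius on the
    zero space does no harm.\<close>
  case True
  then show ?thesis
    using cinner_scaleR_right[of "T x" 0 x] by simp
next
  case False
  interpret T: bounded_linear T
    using assms by (simp add: bounded_clinear_def)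
  have "cmod (cinner (T y) y) \<le> onorm T" if "norm y = 1" for y
    using cmod_cinner_le_norm[of "T y" y] onorm[OF T.bounded_linear_axioms, of y] that by simp
  then have bdd: "bdd_above ((\<lambda>y. cmod (cinner (T y) y)) ` {y. norm y = 1})"
    by (auto simp: bdd_above_def)
  define y where "y = (1 / norm x) *\<^sub>R x"
  have "norm y = 1"
    using False by (simp add: y_def)
  then have "cmod (cinner (T y) y) \<le> numerical_radius T"
    unfolding numerical_radius_def by (intro cSUP_upper bdd) simp
  moreover have "cmod (cinner (T y) y) = cmod (cinner (T x) x) / (norm x)\<^sup>2"
    by (simp add: y_def T.scaleR cinner_scaleR_left cinner_scaleR_right norm_mult norm_divide
        power2_eq_square)
  ultimately show ?thesis
    using False by (simp add: divide_le_eq)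
qed

text \<open>The operator is self-adjoint with quadratic form twice the real part of
  \<open>\<alpha> * cinner (T x) x\<close>. The sign hypothesis covers the zero space, where the
  numerical radius is an unspecified number.\<close>

lemma onorm_real_part_le_numerical_radius:
  fixes T :: "'a::chilbert_space \<Rightarrow> 'a"
  assumes "bounded_clinear T" and "numerical_radius T \<ge> 0"
  shows "onorm (\<lambda>x. \<alpha> *\<^sub>C T x + cnj \<alpha> *\<^sub>C hadjoint T x) \<le> 2 * cmod \<alpha> * numerical_radius T"
proof (rule onorm_selfadjoint_le)
  have "bounded_linear T" "bounded_linear (hadjoint T)"
    using assms(1) bounded_clinear_hadjoint[OF assms(1)] by (simp_all add: bounded_clinear_def)
  then show "bounded_linear (\<lambda>x. \<alpha> *\<^sub>C T x + cnj \<alpha> *\<^sub>C hadjoint T x)"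
    by (intro bounded_linear_add bounded_linear_compose[OF bounded_linear_scaleC])
  note cinner_simps = cinner_add_left cinner_add_right cinner_scaleC_left cinner_scaleC_right
    cinner_hadjoint_left[OF assms(1)] cinner_hadjoint_right[OF assms(1)]
  show "cinner (\<alpha> *\<^sub>C T x + cnj \<alpha> *\<^sub>C hadjoint T x) y
      = cinner x (\<alpha> *\<^sub>C T y + cnj \<alpha> *\<^sub>C hadjoint T y)" for x y
    by (simp add: cinner_simps)
  show "cmod (cinner (\<alpha> *\<^sub>C T x + cnj \<alpha> *\<^sub>C hadjoint T x) x)
      \<le> 2 * cmod \<alpha> * numerical_radius T * (norm x)\<^sup>2" for x
  proof -
    have "cmod (cinner (\<alpha> *\<^sub>C T x + cnj \<alpha> *\<^sub>C hadjoint T x) x)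
        \<le> cmod (\<alpha> * cinner (T x) x) + cmod (cnj \<alpha> * cinner x (T x))"
      using norm_triangle_ineq by (simp add: cinner_simps)
    also have "\<dots> = 2 * cmod \<alpha> * cmod (cinner (T x) x)"
      using cinner_commute[of x "T x"] by (simp add: norm_mult)
    also have "\<dots> \<le> 2 * cmod \<alpha> * (numerical_radius T * (norm x)\<^sup>2)"
      by (intro mult_left_mono cmod_cinner_le_numerical_radius assms) simp
    finally show ?thesis by (simp add: mult.assoc)
  qed
qed (use assms(2) in simp)

section \<open>Combining the two estimates\<close>

lemma onorm_square_add_square_le:
  fixes P M :: "'a::real_normed_vector \<Rightarrow> 'a"
  assumes P: "bounded_linear P" and M: "bounded_linear M"
  shows "onorm (\<lambda>x. P (P x) + M (M x)) \<le> (onorm P)\<^sup>2 + (onorm M)\<^sup>2"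
proof -
  have "onorm (\<lambda>x. P (P x) + M (M x)) \<le> onorm (P \<circ> P) + onorm (M \<circ> M)"
    using onorm_triangle[OF bounded_linear_compose[OF P P] bounded_linear_compose[OF M M]]
    by (simp add: o_def)
  then show ?thesis
    using onorm_compose[OF P P] onorm_compose[OF M M] by (simp add: power2_eq_square)
qed

text \<open>The numerical core, with \<open>N\<close>, \<open>p\<close>, \<open>m\<close>,
  \<open>w\<close> standing for the norms of \<open>T\<^sup>*T + TT\<^sup>*\<close>,
  \<open>P\<close>, \<open>M\<close> and for the numerical radius. The bound \<open>w_ge\<close> may
  be conditional because the first equation makes \<open>w\<close> a square root, hence
  nonnegative.\<close>

lemma sqrt_norm_identity_iff:
  fixes w N p m :: real
  assumes "N \<ge> 0" "p \<ge> 0" "m \<ge> 0" and N_le: "N \<le> p\<^sup>2 + m\<^sup>2"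
    and w_ge: "w \<ge> 0 \<Longrightarrow> p \<le> sqrt 2 * w \<and> m \<le> sqrt 2 * w"
  shows "w = sqrt (1/4 * N + 1/4 * \<bar>p\<^sup>2 - m\<^sup>2\<bar>)
    \<longleftrightarrow> N = p\<^sup>2 + m\<^sup>2 \<and> w = max (p / sqrt 2) (m / sqrt 2)"
proof -
  define \<mu> where "\<mu> = max (p / sqrt 2) (m / sqrt 2)"
  have "\<mu> \<ge> 0"
    using assms by (simp add: \<mu>_def max_def)
  \<comment> \<open>The maximum of two reals is half of their sum plus half of their distance, here
    for \<open>p\<^sup>2 / 2\<close> and \<open>m\<^sup>2 / 2\<close>.\<close>
  have \<mu>2: "\<mu>\<^sup>2 = 1/4 * (p\<^sup>2 + m\<^sup>2) + 1/4 * \<bar>p\<^sup>2 - m\<^sup>2\<bar>"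
  proof (cases "p \<le> m")
    case True
    then have "\<mu>\<^sup>2 = m\<^sup>2 / 2" "p\<^sup>2 \<le> m\<^sup>2"
      using \<open>p \<ge> 0\<close> by (simp_all add: \<mu>_def max_def divide_le_cancel power_divide power_mono)
    then show ?thesis by (simp add: abs_if field_simps)
  next
    case False
    then have "\<mu>\<^sup>2 = p\<^sup>2 / 2" "m\<^sup>2 \<le> p\<^sup>2"
      using \<open>m \<ge> 0\<close> by (simp_all add: \<mu>_def max_def divide_le_cancel power_divide power_mono)
    then show ?thesis by (simp add: abs_if field_simps)
  qed
  show ?thesis
    unfolding \<mu>_def[symmetric]
  proof
    assume w: "w = sqrt (1/4 * N + 1/4 * \<bar>p\<^sup>2 - m\<^sup>2\<bar>)"
    then have "w \<ge> 0" using \<open>N \<ge> 0\<close> by simp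
    have w2: "w\<^sup>2 = 1/4 * N + 1/4 * \<bar>p\<^sup>2 - m\<^sup>2\<bar>"
      using w \<open>N \<ge> 0\<close> by simp
    have "\<mu> \<le> w"
      using w_ge[OF \<open>w \<ge> 0\<close>] by (simp add: \<mu>_def divide_le_eq mult.commute)
    then have "\<mu>\<^sup>2 \<le> w\<^sup>2"
      using \<open>\<mu> \<ge> 0\<close> by (rule power_mono)
    \<comment> \<open>The absolute values cancel, so \<open>\<mu>\<^sup>2 \<le> w\<^sup>2\<close> is
      the reverse of \<open>N_le\<close>.\<close>
    then have "N = p\<^sup>2 + m\<^sup>2" using w2 \<mu>2 N_le by simp
    then have "w\<^sup>2 = \<mu>\<^sup>2" using w2 \<mu>2 by simp
    then show "N = p\<^sup>2 + m\<^sup>2 \<and> w = \<mu>"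
      using \<open>N = p\<^sup>2 + m\<^sup>2\<close> \<open>w \<ge> 0\<close> \<open>\<mu> \<ge> 0\<close> by simp
  next
    assume "N = p\<^sup>2 + m\<^sup>2 \<and> w = \<mu>"
    then show "w = sqrt (1/4 * N + 1/4 * \<bar>p\<^sup>2 - m\<^sup>2\<bar>)"
      using \<mu>2 \<open>\<mu> \<ge> 0\<close> by (metis real_sqrt_unique)
  qed
qed

theorem mainTheorem15:
  fixes T :: "'a::chilbert_space \<Rightarrow> 'a"
  assumes "bounded_clinear T"
  shows "numerical_radius T =
      sqrt (1 / 4 * onorm (\<lambda>x. hadjoint T (T x) + T (hadjoint T x))
        + 1 / 4 * \<bar>(onorm (\<lambda>x. op_Re T x + op_Im T x))\<^sup>2 - (onorm (\<lambda>x. op_Re T x - op_Im T x))\<^sup>2\<bar>)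
    \<longleftrightarrow>
      onorm (\<lambda>x. hadjoint T (T x) + T (hadjoint T x))
        = (onorm (\<lambda>x. op_Re T x + op_Im T x))\<^sup>2 + (onorm (\<lambda>x. op_Re T x - op_Im T x))\<^sup>2
      \<and> numerical_radius T =
          max (onorm (\<lambda>x. op_Re T x + op_Im T x) / sqrt 2) (onorm (\<lambda>x. op_Re T x - op_Im T x) / sqrt 2)"
proof -
  let ?S = "hadjoint T"
  \<comment> \<open>The coefficient of \<open>T\<close> in \<open>op_Re T + op_Im T\<close>, namely
    \<open>1 / 2 + 1 / (2 * \<i>)\<close>; passing to \<open>M\<close> exchanges it with its
    conjugate.\<close>
  define \<alpha> :: complex where "\<alpha> = (1 - \<i>) / 2"
  define P where "P = (\<lambda>x. op_Re T x + op_Im T x)"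
  define M where "M = (\<lambda>x. op_Re T x - op_Im T x)"
  interpret T: bounded_linear T
    using assms by (simp add: bounded_clinear_def)
  interpret S: bounded_linear ?S
    using bounded_clinear_hadjoint[OF assms] by (simp add: bounded_clinear_def)
  have scaleC: "T (c *\<^sub>C x) = c *\<^sub>C T x" "?S (c *\<^sub>C x) = c *\<^sub>C ?S x" for c x
    using assms bounded_clinear_hadjoint[OF assms] by (simp_all add: bounded_clinear_def)
  have coeff: "\<alpha> = 1 / 2 + 1 / (2 * \<i>)" "cnj \<alpha> = 1 / 2 - 1 / (2 * \<i>)"
    by (simp_all add: \<alpha>_def complex_eq_iff)
  have scaleC_diff_left: "(a - b) *\<^sub>C x = a *\<^sub>C x - b *\<^sub>C x" for a b and x :: 'a
    by (metis add_diff_cancel diff_add_cancel scaleC_add_left)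
  have collect:
      "a *\<^sub>C (u + v) + b *\<^sub>C (u - v) = (a + b) *\<^sub>C u + (a - b) *\<^sub>C v"
      "a *\<^sub>C (u + v) - b *\<^sub>C (u - v) = (a - b) *\<^sub>C u + (a + b) *\<^sub>C v" for a b and u v :: 'a
    by (simp_all only: scaleC_add_left scaleC_diff_left scaleC_add_right scaleC_diff_right)
      (simp_all add: algebra_simps)
  have P: "P = (\<lambda>x. \<alpha> *\<^sub>C T x + cnj \<alpha> *\<^sub>C ?S x)"
    \<comment> \<open>\<open>coeff(2)\<close> has to come first: rewriting \<alpha> by
      \<open>coeff(1)\<close> would destroy the pattern \<open>cnj \<alpha>\<close>.\<close>
    unfolding P_def coeff(2) unfolding coeff(1) op_Re_def op_Im_def collect ..
  have M: "M = (\<lambda>x. cnj \<alpha> *\<^sub>C T x + \<alpha> *\<^sub>C ?S x)"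
    unfolding M_def op_Re_def op_Im_def collect coeff(2) unfolding coeff(1) ..
  have bl: "bounded_linear P" "bounded_linear M"
    unfolding P M
    by (intro bounded_linear_add bounded_linear_compose[OF bounded_linear_scaleC]
        T.bounded_linear_axioms S.bounded_linear_axioms)+
  have double: "(2 * a) *\<^sub>C x = a *\<^sub>C x + a *\<^sub>C x" for a and x :: 'a
    by (metis mult_2 scaleC_add_left)
  have squares: "?S (T x) + T (?S x) = P (P x) + M (M x)" for x
  proof -
    \<comment> \<open>The squares of \<alpha> and its conjugate are opposite, which removes the
      terms \<open>T (T x)\<close> and \<open>?S (?S x)\<close>; the mixed terms keep the weight
      \<open>2 * (\<alpha> * cnj \<alpha>) = 1\<close>.\<close>
    have "P (P x) + M (M x) = (\<alpha> * \<alpha> + cnj \<alpha> * cnj \<alpha>) *\<^sub>C (T (T x) + ?S (?S x))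
        + (2 * (\<alpha> * cnj \<alpha>)) *\<^sub>C (?S (T x) + T (?S x))"
      unfolding P M
      by (simp add: double T.add S.add scaleC scaleC_scaleC scaleC_add_left scaleC_add_right
          add_ac mult.commute[of "cnj \<alpha>" \<alpha>])
    moreover have "\<alpha> * \<alpha> + cnj \<alpha> * cnj \<alpha> = 0" "2 * (\<alpha> * cnj \<alpha>) = 1"
      by (simp_all add: \<alpha>_def complex_eq_iff)
    moreover have "0 *\<^sub>C y = 0" for y :: 'a
      using scaleC_diff_left[of 0 0 y] by simp
    ultimately show ?thesis
      by (simp add: scaleC_one)
  qed
  have "2 * cmod \<alpha> = sqrt 2"
    by (simp add: \<alpha>_def cmod_def power2_eq_square real_sqrt_divide real_div_sqrt)
  \<comment> \<open>The estimate for \<alpha> concerns \<open>P\<close>, the one for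
    \<open>cnj \<alpha>\<close> concerns \<open>M\<close>; both coefficients have the same
    modulus.\<close>
  then have w_ge: "onorm P \<le> sqrt 2 * numerical_radius T \<and> onorm M \<le> sqrt 2 * numerical_radius T"
    if "numerical_radius T \<ge> 0"
    using onorm_real_part_le_numerical_radius[OF assms that, of \<alpha>]
      onorm_real_part_le_numerical_radius[OF assms that, of "cnj \<alpha>"]
    by (simp add: P M)
  show ?thesis
    unfolding P_def[symmetric] M_def[symmetric] squares
  proof (rule sqrt_norm_identity_iff)
    show "onorm (\<lambda>x. P (P x) + M (M x)) \<ge> 0"
      by (intro onorm_pos_le bounded_linear_add bounded_linear_compose[OF bl(1) bl(1)]
          bounded_linear_compose[OF bl(2) bl(2)])
  qed (fact onorm_pos_le[OF bl(1)] onorm_pos_le[OF bl(2)] onorm_square_add_square_le[OF bl] w_ge)+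
qed

end
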